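(* Let $r\ge 2$ and $d\ge 3$ be integers. Let $U$ and $U'$ be independent copies of a random variable taking values in a finite set $\mathcal X$. For each $i\in[r]$, let $\mathcal H_i$ be a real Hilbert space and let $\sigma_i:\mathcal X\to\mathcal H_i$ be an arbitrary map. Set $Z_i=\langle \sigma_i(U),\sigma_i(U')\rangle_{\mathcal H_i}$. Then there exist $i\in[r]$ and a real number $\lambda\ge -1$ such that $$\mathbb P\bigl(Z_i\ge\lambda,\ Z_j\ge -1\text{ for every } j\ne i\bigr)\ \ge\ \beta_r\exp\!\left(-C_{r,d}(\lambda+1)^{1/d}\right),$$ where $\beta_r=\dfrac{1}{4D_r(r+1)}$ with $D_r=r2^{r-1}$, and $C_{r,d}=4r\,u_{r,d}$. In particular, there are absolute constants $C_1,C_2>0$ (independent of $r$ and $d$) such that $$C_{r,d}\le C_1\, r d^2\log(2rd),\qquad \log(1/\beta_r)\le C_2\, r .$$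
   Context: $[r]=\{1,\dots,r\}$ and $\log$ is the natural logarithm. For integers $r\ge2$, $d\ge 3$, put $\theta_d=\pi/d$, $\eta_d=1-\cos(2\theta_d)$, $\gamma_d=1-\cos\theta_d$, and $$u_{r,d}=\max\left\{1,\ \frac{\log(2(d-1))}{\eta_d},\ \frac{\log(24d^2r)}{2\gamma_d}\right\}.$$ *)

theory Defs
  imports "HOL-Probability.Probability" "HOL-Algebra.Module"
begin

text \<open>The Hilbert spaces of the family \<open>(\<H>\<^sub>i)\<close> may be different from each other, so a Hilbert
  space is a structure with an explicit carrier rather than a type of class
  \<^class>\<open>real_inner\<close> and \<^class>\<open>complete_space\<close>. As for every module in \<open>HOL-Algebra\<close>, the fields
  \<open>mult\<close> and \<open>one\<close> of the record are present but not constrained.\<close>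

definition real_ring :: "real ring" where
  "real_ring = \<lparr>carrier = UNIV, mult = (*), one = 1, zero = 0, add = (+)\<rparr>"

record 'a inner_space = "(real, 'a) module" +
  inner_prod :: "'a \<Rightarrow> 'a \<Rightarrow> real"

definition inner_dist :: "('a, 'm) inner_space_scheme \<Rightarrow> 'a \<Rightarrow> 'a \<Rightarrow> real" where
  "inner_dist H x y = sqrt (inner_prod H (x \<ominus>\<^bsub>H\<^esub> y) (x \<ominus>\<^bsub>H\<^esub> y))"

locale real_hilbert_space = Module.module real_ring H
  for H :: "('a, 'm) inner_space_scheme" (structure) +
  assumes inner_prod_commute:
      "\<lbrakk>x \<in> carrier H; y \<in> carrier H\<rbrakk> \<Longrightarrow> inner_prod H x y = inner_prod H y x"
    and inner_prod_add_left:
      "\<lbrakk>x \<in> carrier H; y \<in> carrier H; z \<in> carrier H\<rbrakk> \<Longrightarrow>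
        inner_prod H (x \<oplus> y) z = inner_prod H x z + inner_prod H y z"
    and inner_prod_smult_left:
      "\<lbrakk>x \<in> carrier H; y \<in> carrier H\<rbrakk> \<Longrightarrow> inner_prod H (a \<odot> x) y = a * inner_prod H x y"
    and inner_prod_nonneg: "x \<in> carrier H \<Longrightarrow> 0 \<le> inner_prod H x x"
    and inner_prod_eq_zero: "\<lbrakk>x \<in> carrier H; inner_prod H x x = 0\<rbrakk> \<Longrightarrow> x = \<zero>"
    and complete: "Metric_space.mcomplete (carrier H) (inner_dist H)"

text \<open>Every Hilbert space type is an instance.\<close>

definition hilbert_type :: "'h::{real_inner, complete_space} inner_space" where
  "hilbert_type = \<lparr>carrier = UNIV, mult = (\<lambda>x y. undefined), one = undefined,
     zero = 0, add = (+), smult = (*\<^sub>R), inner_prod = (\<bullet>)\<rparr>"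

lemma cring_real_ring: "cring real_ring"
proof (rule cringI)
  show "abelian_group real_ring"
    by (rule abelian_groupI) (auto simp: real_ring_def intro: exI[of _ "- _"])
  show "Group.comm_monoid real_ring"
    by (rule comm_monoidI) (auto simp: real_ring_def)
qed (auto simp: real_ring_def algebra_simps)

lemma abelian_group_hilbert_type: "abelian_group hilbert_type"
  by (rule abelian_groupI) (auto simp: hilbert_type_def intro: exI[of _ "- _"])

lemma minus_hilbert_type: "x \<ominus>\<^bsub>hilbert_type\<^esub> y = x - y"
proof -
  interpret abelian_group hilbert_type by (rule abelian_group_hilbert_type)
  have "\<ominus>\<^bsub>hilbert_type\<^esub> y = - y"
    by (rule minus_equality) (auto simp: hilbert_type_def)
  then show ?thesis
    by (simp add: a_minus_def) (simp add: hilbert_type_def)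
qed

lemma inner_dist_hilbert_type: "inner_dist hilbert_type = dist"
  by (auto simp: fun_eq_iff inner_dist_def minus_hilbert_type)
     (simp add: hilbert_type_def dist_norm norm_eq_sqrt_inner)

lemma real_hilbert_space_hilbert_type: "real_hilbert_space hilbert_type"
proof (intro real_hilbert_space.intro real_hilbert_space_axioms.intro)
  show "Module.module real_ring hilbert_type"
    by (rule moduleI[OF cring_real_ring abelian_group_hilbert_type])
       (auto simp: real_ring_def hilbert_type_def algebra_simps)
  have "Metric_space.mcomplete (UNIV :: 'a set) dist"
    by (simp add: mcomplete_iff_complete complete_UNIV)
  then show "Metric_space.mcomplete (carrier (hilbert_type :: 'a inner_space)) (inner_dist hilbert_type)"
    unfolding inner_dist_hilbert_type by (simp add: hilbert_type_def)
qed (auto simp: hilbert_type_def inner_add_left intro: inner_commute)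

definition theta :: "nat \<Rightarrow> real" where
  "theta d = pi / real d"

definition eta :: "nat \<Rightarrow> real" where
  "eta d = 1 - cos (2 * theta d)"

definition gam :: "nat \<Rightarrow> real" where
  "gam d = 1 - cos (theta d)"

definition u_const :: "nat \<Rightarrow> nat \<Rightarrow> real" where
  "u_const r d = Max {1, ln (2 * (real d - 1)) / eta d,
     ln (24 * real d ^ 2 * real r) / (2 * gam d)}"

definition D_const :: "nat \<Rightarrow> real" where
  "D_const r = real r * 2 ^ (r - 1)"

definition beta :: "nat \<Rightarrow> real" where
  "beta r = 1 / (4 * D_const r * (real r + 1))"

definition C_const :: "nat \<Rightarrow> nat \<Rightarrow> real" where
  "C_const r d = 4 * real r * u_const r d"

text \<open>The finite set \<open>X\<close> carries the discrete sigma-algebra; \<open>indep_var\<close> includes measurability.\<close>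

definition independent_copies ::
    "'w measure \<Rightarrow> 'x set \<Rightarrow> ('w \<Rightarrow> 'x) \<Rightarrow> ('w \<Rightarrow> 'x) \<Rightarrow> bool" where
  "independent_copies M X U U' \<longleftrightarrow>
     prob_space.indep_var M (count_space X) U (count_space X) U' \<and>
     distr M (count_space X) U = distr M (count_space X) U'"

end

theory Submission
  imports Defs
begin

text \<open>For an entire function of \<open>r\<close> variables with nonnegative coefficients, the expectation at
  \<open>(Z\<^sub>1, \<dots>, Z\<^sub>r)\<close> is nonnegative, because products and sums of positive semidefinite kernels are
  positive semidefinite. With the Mittag-Leffler function \<open>E(x) = \<Sum>n. x\<^sup>n / (dn)!\<close> and the constant
  \<open>c = exp (2 u cos (\<pi>/d))\<close> put \<open>g(z) = E(u\<^sup>d z)\<^sup>2\<close>, \<open>A(z) = (g(z) - g(-z)) / c\<close> and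
  \<open>B(z) = 1 + g(z) / c\<close> (\<open>test_num\<close> and \<open>test_den\<close>), and test with \<open>F(z) = \<Sum>j. A(z\<^sub>j) \<Prod>i\<noteq>j. B(z\<^sub>i)\<close>.
  Since \<open>E(s\<^sup>d)\<close> is the average of \<open>exp (\<omega> s)\<close> over the \<open>d\<close>-th roots of unity \<open>\<omega>\<close>, it grows like
  \<open>exp s / d\<close>, while \<open>E(-s\<^sup>d)\<close> is at most \<open>exp (s cos (\<pi>/d))\<close>. Always \<open>A \<le> B\<close>, and the choice of \<open>u\<close>
  makes \<open>A \<le> (1 - 3r) B\<close> to the left of \<open>-1\<close>; so \<open>F \<le> -r\<close> as soon as some \<open>z\<^sub>i < -1\<close>.
  Where all \<open>z\<^sub>i \<ge> -1\<close>, \<open>F\<close> is at most \<open>D\<^sub>r exp (2 r u (max z\<^sub>i + 1)\<^sup>1\<^sup>/\<^sup>d)\<close>. If the conclusion failed,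
  the tails of \<open>max Z\<^sub>i\<close> would be so thin that this part contributes at most \<open>1/2\<close>, and the
  expectation of \<open>F\<close> would be negative.\<close>

section \<open>Positive semidefinite kernels\<close>

text \<open>Symmetry is a separate clause because a real quadratic form sees only the symmetric part
  of \<open>K\<close>.\<close>

definition psd_kernel :: "'x set \<Rightarrow> ('x \<Rightarrow> 'x \<Rightarrow> real) \<Rightarrow> bool" where
  "psd_kernel X K \<longleftrightarrow> (\<forall>x\<in>X. \<forall>y\<in>X. K x y = K y x) \<and>
     (\<forall>c. 0 \<le> (\<Sum>x\<in>X. \<Sum>y\<in>X. c x * c y * K x y))"

lemma psd_kernelI:
  assumes "\<And>x y. x \<in> X \<Longrightarrow> y \<in> X \<Longrightarrow> K x y = K y x"
    and "\<And>c. 0 \<le> (\<Sum>x\<in>X. \<Sum>y\<in>X. c x * c y * K x y)"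
  shows "psd_kernel X K"
  using assms unfolding psd_kernel_def by blast

lemma psd_kernel_sym: "psd_kernel X K \<Longrightarrow> x \<in> X \<Longrightarrow> y \<in> X \<Longrightarrow> K x y = K y x"
  unfolding psd_kernel_def by blast

lemma psd_kernel_nonneg:
  "psd_kernel X K \<Longrightarrow> 0 \<le> (\<Sum>x\<in>X. \<Sum>y\<in>X. c x * c y * K x y)"
  unfolding psd_kernel_def by blast

lemma psd_kernel_product: "psd_kernel X (\<lambda>x y. f x * f y)"
proof (rule psd_kernelI)
  fix c
  have "(\<Sum>x\<in>X. \<Sum>y\<in>X. c x * c y * (f x * f y)) = (\<Sum>x\<in>X. c x * f x)\<^sup>2"
    by (simp add: power2_eq_square sum_product mult_ac)
  then show "0 \<le> (\<Sum>x\<in>X. \<Sum>y\<in>X. c x * c y * (f x * f y))" by simp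
qed simp

lemma psd_kernel_const: "0 \<le> a \<Longrightarrow> psd_kernel X (\<lambda>x y. a)"
  using psd_kernel_product[of X "\<lambda>_. sqrt a"] by simp

lemma psd_kernel_add:
  assumes "psd_kernel X K" "psd_kernel X L"
  shows "psd_kernel X (\<lambda>x y. K x y + L x y)"
proof (rule psd_kernelI)
  show "K x y + L x y = K y x + L y x" if "x \<in> X" "y \<in> X" for x y
    using psd_kernel_sym[OF assms(1) that] psd_kernel_sym[OF assms(2) that] by simp
  show "0 \<le> (\<Sum>x\<in>X. \<Sum>y\<in>X. c x * c y * (K x y + L x y))" for c
    using psd_kernel_nonneg[OF assms(1), of c] psd_kernel_nonneg[OF assms(2), of c]
    by (simp add: distrib_left sum.distrib)
qed

lemma psd_kernel_sum:
  assumes "\<And>i. i \<in> I \<Longrightarrow> psd_kernel X (K i)"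
  shows "psd_kernel X (\<lambda>x y. \<Sum>i\<in>I. K i x y)"
  using assms
proof (induction I rule: infinite_finite_induct)
  case (insert i I)
  then show ?case by (simp add: psd_kernel_add)
qed (simp_all add: psd_kernel_const)

lemma psd_kernel_cong:
  assumes "psd_kernel X K" "\<And>x y. x \<in> X \<Longrightarrow> y \<in> X \<Longrightarrow> K x y = L x y"
  shows "psd_kernel X L"
proof (rule psd_kernelI)
  show "L x y = L y x" if "x \<in> X" "y \<in> X" for x y
    using psd_kernel_sym[OF assms(1)] assms(2) that by metis
  show "0 \<le> (\<Sum>x\<in>X. \<Sum>y\<in>X. c x * c y * L x y)" for c
    using psd_kernel_nonneg[OF assms(1), of c] by (simp add: assms(2))
qed

lemma psd_kernel_LIMSEQ:
  assumes "\<And>n. psd_kernel X (K n)"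
    and "\<And>x y. x \<in> X \<Longrightarrow> y \<in> X \<Longrightarrow> (\<lambda>n. K n x y) \<longlonglongrightarrow> L x y"
  shows "psd_kernel X L"
proof (rule psd_kernelI)
  fix x y assume xy: "x \<in> X" "y \<in> X"
  have "(\<lambda>n. K n x y) \<longlonglongrightarrow> L y x"
    using assms(2)[OF xy(2,1)] psd_kernel_sym[OF assms(1) xy] by simp
  then show "L x y = L y x"
    using assms(2)[OF xy] LIMSEQ_unique by blast
next
  fix c
  have "(\<lambda>n. \<Sum>x\<in>X. \<Sum>y\<in>X. c x * c y * K n x y) \<longlonglongrightarrow> (\<Sum>x\<in>X. \<Sum>y\<in>X. c x * c y * L x y)"
    by (intro tendsto_sum tendsto_mult tendsto_const assms(2))
  then show "0 \<le> (\<Sum>x\<in>X. \<Sum>y\<in>X. c x * c y * L x y)"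
    by (rule LIMSEQ_le_const) (use psd_kernel_nonneg[OF assms(1)] in blast)
qed

text \<open>Gram factorisation by Cholesky elimination of one point at a time. If the pivot \<open>K a a\<close>
  vanishes, then so does its whole row, and division by zero yields the right value \<open>0\<close>.\<close>

lemma psd_kernel_Gram:
  assumes "finite X" "psd_kernel X K"
  shows "\<exists>n f. \<forall>x\<in>X. \<forall>y\<in>X. K x y = (\<Sum>k<(n::nat). f k x * f k y)"
  using assms
proof (induction X arbitrary: K rule: finite_induct)
  case (insert a X)
  note sym = psd_kernel_sym[OF insert.prems]
  define L where "L c = (\<Sum>x\<in>X. c x * K x a)" for c
  define Q where "Q c = (\<Sum>x\<in>X. \<Sum>y\<in>X. c x * c y * K x y)" for c
  have quad: "0 \<le> t\<^sup>2 * K a a + 2 * t * L c + Q c" for t c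
  proof -
    define c' where "c' = c(a := t)"
    have c': "c' a = t" "\<And>x. x \<in> X \<Longrightarrow> c' x = c x"
      using insert.hyps by (auto simp: c'_def)
    have "0 \<le> (\<Sum>x\<in>insert a X. \<Sum>y\<in>insert a X. c' x * c' y * K x y)"
      by (rule psd_kernel_nonneg[OF insert.prems])
    also have "\<dots> = t * t * K a a + (\<Sum>y\<in>X. t * c y * K a y)
        + (\<Sum>x\<in>X. c x * t * K x a + (\<Sum>y\<in>X. c x * c y * K x y))"
      using insert.hyps by (simp add: c')
    also have "(\<Sum>y\<in>X. t * c y * K a y) = t * L c"
      unfolding L_def sum_distrib_left by (intro sum.cong refl) (simp add: sym)
    also have "(\<Sum>x\<in>X. c x * t * K x a + (\<Sum>y\<in>X. c x * c y * K x y)) = t * L c + Q c"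
      unfolding L_def Q_def sum_distrib_left sum.distrib by (simp add: mult_ac)
    finally show ?thesis by (simp add: power2_eq_square algebra_simps)
  qed
  have Kaa: "0 \<le> K a a"
    using quad[of 1 "\<lambda>_. 0"] by (simp add: L_def Q_def)
  have row: "K x a = 0" if "K a a = 0" "x \<in> insert a X" for x
  proof (rule ccontr)
    assume nz: "K x a \<noteq> 0"
    then have x: "x \<in> X" using that by auto
    define c where "c = (\<lambda>y. if y = x then 1 else 0 :: real)"
    have "L c = (\<Sum>y\<in>X. if y = x then K y a else 0)"
      unfolding L_def c_def by (intro sum.cong) auto
    then have "L c = K x a"
      using x insert.hyps by simp
    \<comment> \<open>With a zero pivot the bound \<open>quad\<close> is affine in \<open>t\<close>;
      if its slope were nonzero, this \<open>t\<close> would make the right side equal to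
      -1.\<close>
    moreover have "0 \<le> 2 * (- (Q c + 1) / (2 * L c)) * L c + Q c"
      using quad[of "- (Q c + 1) / (2 * L c)" c] that by simp
    ultimately show False
      using nz by (simp add: field_simps)
  qed
  \<comment> \<open>\<open>K'\<close> is the Schur complement of the pivot. Its quadratic form is
    the minimum of \<open>quad\<close> over \<open>t\<close>, attained at
    \<open>t = - L c / K a a\<close> when the pivot is nonzero.\<close>
  define K' where "K' = (\<lambda>x y. K x y - K x a * K y a / K a a)"
  have "psd_kernel X K'"
  proof (rule psd_kernelI)
    show "K' x y = K' y x" if "x \<in> X" "y \<in> X" for x y
      using that sym by (simp add: K'_def mult.commute)
    fix c
    have "(\<Sum>x\<in>X. \<Sum>y\<in>X. c x * c y * K' x y)
        = Q c - (\<Sum>x\<in>X. \<Sum>y\<in>X. (c x * K x a) * (c y * K y a) / K a a)"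
      unfolding Q_def sum_subtractf[symmetric] K'_def
      by (intro sum.cong refl) (simp add: algebra_simps)
    also have "(\<Sum>x\<in>X. \<Sum>y\<in>X. (c x * K x a) * (c y * K y a) / K a a) = (L c)\<^sup>2 / K a a"
      unfolding L_def power2_eq_square sum_product sum_divide_distrib by simp
    also have "0 \<le> Q c - (L c)\<^sup>2 / K a a"
    proof (cases "K a a = 0")
      case True
      then show ?thesis using quad[of 0 c] by simp
    next
      case False
      then show ?thesis
        using quad[of "- L c / K a a" c] by (simp add: field_simps power2_eq_square)
    qed
    finally show "0 \<le> (\<Sum>x\<in>X. \<Sum>y\<in>X. c x * c y * K' x y)" by simp
  qed
  from insert.IH[OF this] obtain n f
    where f: "\<And>x y. x \<in> X \<Longrightarrow> y \<in> X \<Longrightarrow> K' x y = (\<Sum>k<(n::nat). f k x * f k y)"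
    by blast
  define g where "g k x = (if k < n then if x = a then 0 else f k x else K x a / sqrt (K a a))" for k x
  have "K x y = (\<Sum>k<Suc n. g k x * g k y)" if xy: "x \<in> insert a X" "y \<in> insert a X" for x y
  proof -
    have "(\<Sum>k<Suc n. g k x * g k y) =
        (\<Sum>k<n. if x = a \<or> y = a then 0 else f k x * f k y) + K x a * K y a / K a a"
      using Kaa by (simp add: g_def) (intro sum.cong; simp)
    also have "\<dots> = K x y"
    proof (cases "x = a \<or> y = a")
      case True
      moreover have "K a y = K y a" using sym xy by simp
      ultimately show ?thesis
        using row xy by (cases "K a a = 0") auto
    next
      case False
      then have "x \<in> X" "y \<in> X" using xy by auto
      then show ?thesis
        using False by (simp add: f[symmetric] K'_def)
    qed
    finally show ?thesis by simp
  qed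
  then show ?case by blast
qed simp

text \<open>Schur product theorem. Once \<open>K\<close> is a Gram matrix, the quadratic form of the
  product is a sum over \<open>k\<close> of quadratic forms of \<open>L\<close> with coefficients
  \<open>c x * f k x\<close>.\<close>

theorem psd_kernel_mult:
  assumes "finite X" "psd_kernel X K" "psd_kernel X L"
  shows "psd_kernel X (\<lambda>x y. K x y * L x y)"
proof (rule psd_kernelI)
  show "K x y * L x y = K y x * L y x" if "x \<in> X" "y \<in> X" for x y
    using psd_kernel_sym[OF assms(2) that] psd_kernel_sym[OF assms(3) that] by simp
  fix c
  obtain n f where f: "\<And>x y. x \<in> X \<Longrightarrow> y \<in> X \<Longrightarrow> K x y = (\<Sum>k<(n::nat). f k x * f k y)"
    using psd_kernel_Gram[OF assms(1,2)] by blast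
  have "0 \<le> (\<Sum>k<n. \<Sum>x\<in>X. \<Sum>y\<in>X. (c x * f k x) * (c y * f k y) * L x y)"
    by (intro sum_nonneg psd_kernel_nonneg[OF assms(3)])
  also have "\<dots> = (\<Sum>x\<in>X. \<Sum>y\<in>X. \<Sum>k<n. (c x * f k x) * (c y * f k y) * L x y)"
    by (subst sum.swap, intro sum.cong refl, rule sum.swap)
  also have "\<dots> = (\<Sum>x\<in>X. \<Sum>y\<in>X. c x * c y * (K x y * L x y))"
    by (intro sum.cong refl) (simp add: f sum_distrib_left sum_distrib_right mult_ac)
  finally show "0 \<le> (\<Sum>x\<in>X. \<Sum>y\<in>X. c x * c y * (K x y * L x y))" .
qed

lemma psd_kernel_prod:
  assumes "finite X" "\<And>i. i \<in> I \<Longrightarrow> psd_kernel X (K i)"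
  shows "psd_kernel X (\<lambda>x y. \<Prod>i\<in>I. K i x y)"
  using assms(2)
proof (induction I rule: infinite_finite_induct)
  case (insert i I)
  then show ?case by (simp add: psd_kernel_mult[OF assms(1)])
qed (simp_all add: psd_kernel_const)

lemma psd_kernel_cmult:
  "finite X \<Longrightarrow> 0 \<le> a \<Longrightarrow> psd_kernel X K \<Longrightarrow> psd_kernel X (\<lambda>x y. a * K x y)"
  by (intro psd_kernel_mult psd_kernel_const)

lemma psd_kernel_power:
  "finite X \<Longrightarrow> psd_kernel X K \<Longrightarrow> psd_kernel X (\<lambda>x y. K x y ^ n)"
  using psd_kernel_prod[of X "{..<n}" "\<lambda>_. K"] by simp

lemma psd_kernel_power_series:
  assumes "finite X" "psd_kernel X K" "\<And>n. 0 \<le> a n"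
    and "\<And>x y. x \<in> X \<Longrightarrow> y \<in> X \<Longrightarrow> (\<lambda>n. a n * K x y ^ n) sums \<phi> (K x y)"
  shows "psd_kernel X (\<lambda>x y. \<phi> (K x y))"
proof (rule psd_kernel_LIMSEQ)
  show "psd_kernel X (\<lambda>x y. \<Sum>k<n. a k * K x y ^ k)" for n
    by (intro psd_kernel_sum psd_kernel_cmult psd_kernel_power assms)
qed (use assms(4) in \<open>simp add: sums_def\<close>)

text \<open>The quadratic form is the squared norm of the linear combination of the vectors
  \<open>f x\<close> with coefficients \<open>c x\<close>.\<close>

lemma (in real_hilbert_space) psd_kernel_inner_prod:
  assumes "finite X" "f \<in> X \<rightarrow> carrier H"
  shows "psd_kernel X (\<lambda>x y. inner_prod H (f x) (f y))"
proof (rule psd_kernelI)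
  show "inner_prod H (f x) (f y) = inner_prod H (f y) (f x)" if "x \<in> X" "y \<in> X" for x y
    using that assms(2) by (intro inner_prod_commute) auto
  fix c
  have smult: "a \<odot> x \<in> carrier H" if "x \<in> carrier H" for a x
    by (rule smult_closed) (use that in \<open>simp_all add: real_ring_def\<close>)
  have zero: "inner_prod H \<zero> z = 0" if "z \<in> carrier H" for z
    using inner_prod_add_left[of \<zero> \<zero> z] that by simp
  \<comment> \<open>The linear combination is described only by its inner products with elements of
    the carrier, and is built one point at a time.\<close>
  have "\<exists>v\<in>carrier H. \<forall>z\<in>carrier H. inner_prod H v z = (\<Sum>x\<in>X. c x * inner_prod H (f x) z)"
    using assms
  proof (induction X rule: finite_induct)
    case empty
    then show ?case using zero by auto
  next
    case (insert a X)
    then obtain v where v: "v \<in> carrier H"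
        "\<And>z. z \<in> carrier H \<Longrightarrow> inner_prod H v z = (\<Sum>x\<in>X. c x * inner_prod H (f x) z)"
      by auto
    have fa: "f a \<in> carrier H" using insert.prems by auto
    show ?case
    proof (intro bexI ballI)
      show "c a \<odot> f a \<oplus> v \<in> carrier H" using v fa smult by simp
      show "inner_prod H (c a \<odot> f a \<oplus> v) z = (\<Sum>x\<in>insert a X. c x * inner_prod H (f x) z)"
        if "z \<in> carrier H" for z
        using that insert.hyps v fa smult inner_prod_smult_left
        by (simp add: inner_prod_add_left)
    qed
  qed
  then obtain v where v: "v \<in> carrier H"
      "\<And>z. z \<in> carrier H \<Longrightarrow> inner_prod H v z = (\<Sum>x\<in>X. c x * inner_prod H (f x) z)"
    by blast
  have fX: "f x \<in> carrier H" if "x \<in> X" for x using that assms(2) by auto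
  have "0 \<le> inner_prod H v v" using v by (intro inner_prod_nonneg)
  also have "\<dots> = (\<Sum>x\<in>X. c x * inner_prod H v (f x))"
    using v fX by (simp add: inner_prod_commute)
  also have "\<dots> = (\<Sum>x\<in>X. \<Sum>y\<in>X. c x * c y * inner_prod H (f x) (f y))"
  proof (intro sum.cong refl)
    fix x assume "x \<in> X"
    then have "c x * inner_prod H v (f x) = (\<Sum>y\<in>X. c x * c y * inner_prod H (f y) (f x))"
      using v fX by (simp add: sum_distrib_left mult.assoc)
    also have "\<dots> = (\<Sum>y\<in>X. c x * c y * inner_prod H (f x) (f y))"
      using \<open>x \<in> X\<close> fX by (intro sum.cong refl) (simp add: inner_prod_commute)
    finally show "c x * inner_prod H v (f x) = (\<Sum>y\<in>X. c x * c y * inner_prod H (f x) (f y))" .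
  qed
  finally show "0 \<le> (\<Sum>x\<in>X. \<Sum>y\<in>X. c x * c y * inner_prod H (f x) (f y))" .
qed

section \<open>The Mittag-Leffler function\<close>

text \<open>This is a geometric sum in \<open>w\<close>, the \<open>n\<close>-th power of a
  primitive \<open>d\<close>-th root of unity: \<open>w ^ d = 1\<close>, and \<open>w = 1\<close>
  exactly when \<open>d\<close> divides \<open>n\<close>.\<close>

lemma sum_cis_power:
  fixes d n :: nat
  assumes "0 < d"
  shows "(\<Sum>k<d. cis (2 * pi * real k / real d) ^ n) = (if d dvd n then of_nat d else 0)"
proof -
  define w where "w = cis (2 * pi * real n / real d)"
  have eq: "(\<Sum>k<d. cis (2 * pi * real k / real d) ^ n) = (\<Sum>k<d. w ^ k)"
    by (intro sum.cong) (simp_all add: w_def Complex.DeMoivre mult_ac)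
  have wd: "w ^ d = 1"
    using assms cis_multiple_2pi[of "real n"] by (simp add: w_def Complex.DeMoivre mult_ac)
  show ?thesis
  proof (cases "d dvd n")
    case True
    then obtain m where "n = d * m" by blast
    then have "w = 1"
      using assms cis_multiple_2pi[of "real m"] by (simp add: w_def mult_ac)
    then show ?thesis using True eq by simp
  next
    case False
    have "w \<noteq> 1"
    proof
      assume "w = 1"
      then have "cos (2 * pi * real n / real d) = 1" by (metis w_def cis.sel(1) one_complex.sel(1))
      then obtain m :: int where "2 * pi * real n / real d = of_int m * 2 * pi"
        using cos_one_2pi_int by auto
      then have "real n = of_int m * real d" using assms by (simp add: field_simps)
      then have "of_int (int n) = (of_int (m * int d) :: real)" by simp
      then have "int n = m * int d" unfolding of_int_eq_iff .
      then have "int d dvd int n" by simp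
      then show False using False by (simp add: int_dvd_int_iff)
    qed
    then show ?thesis using False eq wd by (simp add: geometric_sum)
  qed
qed

text \<open>Averaging the exponential series over all rotations by \<open>d\<close>-th roots of
  unity keeps exactly the terms whose exponent is a multiple of \<open>d\<close>.\<close>

lemma exp_multisection:
  fixes z :: complex
  assumes "0 < d"
  shows "(\<lambda>n. z ^ (d * n) / fact (d * n)) sums
    ((\<Sum>k<d. exp (cis (2 * pi * real k / real d) * z)) / of_nat d)"
proof -
  let ?\<omega> = "\<lambda>k. cis (2 * pi * real k / real d)"
  define g where "g n = (if d dvd n then z ^ n / fact n else 0)" for n
  have "(\<lambda>n. \<Sum>k<d. (?\<omega> k * z) ^ n /\<^sub>R fact n) sums (\<Sum>k<d. exp (?\<omega> k * z))"
    by (intro sums_sum exp_converges)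
  moreover have "(\<Sum>k<d. (?\<omega> k * z) ^ n /\<^sub>R fact n) = of_nat d * g n" for n
  proof -
    have "(\<Sum>k<d. (?\<omega> k * z) ^ n /\<^sub>R fact n) = (\<Sum>k<d. ?\<omega> k ^ n) * (z ^ n / fact n)"
      unfolding sum_distrib_right
      by (intro sum.cong refl) (simp add: power_mult_distrib scaleR_conv_of_real field_simps)
    then show ?thesis by (simp add: sum_cis_power[OF assms] g_def)
  qed
  ultimately have "(\<lambda>n. of_nat d * g n) sums (\<Sum>k<d. exp (?\<omega> k * z))" by simp
  from sums_divide[OF this, of "of_nat d"]
  have "g sums ((\<Sum>k<d. exp (?\<omega> k * z)) / of_nat d)" using assms by simp
  moreover have "strict_mono (\<lambda>n. d * n)" using assms by (simp add: strict_mono_def)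
  moreover have "g n = 0" if "n \<notin> range (\<lambda>n. d * n)" for n
    using that by (auto simp: g_def)
  ultimately have "(\<lambda>n. g (d * n)) sums ((\<Sum>k<d. exp (?\<omega> k * z)) / of_nat d)"
    by (subst sums_mono_reindex)
  then show ?thesis by (simp add: g_def)
qed

text \<open>For \<open>d = 1\<close> this is \<open>exp\<close>; for \<open>d = 2\<close> it is
  \<open>cosh (sqrt x)\<close> when \<open>x \<ge> 0\<close> and \<open>cos (sqrt (- x))\<close>
  when \<open>x \<le> 0\<close>. The contrast between growth on the right and slower growth or decay
  on the left drives the proof.\<close>

definition mittag_leffler :: "nat \<Rightarrow> real \<Rightarrow> real" where
  "mittag_leffler d x = (\<Sum>n. x ^ n / fact (d * n))"

lemma mittag_leffler_sums:
  assumes "0 < d"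
  shows "(\<lambda>n. x ^ n / fact (d * n)) sums mittag_leffler d x"
proof -
  have "summable (\<lambda>n. x ^ n / fact (d * n))"
  proof (rule summable_comparison_test)
    show "summable (\<lambda>n. inverse (fact n) * \<bar>x\<bar> ^ n)" by (rule summable_exp)
    have "norm (x ^ n / fact (d * n)) \<le> inverse (fact n) * \<bar>x\<bar> ^ n" for n
    proof -
      have "n \<le> d * n" using assms by simp
      then have "fact n \<le> (fact (d * n) :: real)" by (rule fact_mono)
      then have "\<bar>x\<bar> ^ n / fact (d * n) \<le> \<bar>x\<bar> ^ n / fact n"
        by (intro divide_left_mono) auto
      then show ?thesis by (simp add: abs_mult power_abs divide_inverse mult_ac)
    qed
    then show "\<exists>N. \<forall>n\<ge>N. norm (x ^ n / fact (d * n)) \<le> inverse (fact n) * \<bar>x\<bar> ^ n" by blast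
  qed
  then show ?thesis by (simp add: mittag_leffler_def summable_sums)
qed

text \<open>Any complex \<open>d\<close>-th root \<open>z\<close> of \<open>x\<close> is allowed:
  the real root serves \<open>x \<ge> 0\<close>, and a root rotated by \<open>pi / d\<close> serves
  \<open>x \<le> 0\<close>.\<close>

lemma mittag_leffler_eq_sum_exp:
  assumes "0 < d" "z ^ d = of_real x"
  shows "of_real (mittag_leffler d x) =
    (\<Sum>k<d. exp (cis (2 * pi * real k / real d) * z)) / of_nat d"
proof (rule sums_unique2)
  show "(\<lambda>n. complex_of_real (x ^ n / fact (d * n))) sums of_real (mittag_leffler d x)"
    by (intro sums_of_real mittag_leffler_sums assms)
  show "(\<lambda>n. complex_of_real (x ^ n / fact (d * n))) sums
      ((\<Sum>k<d. exp (cis (2 * pi * real k / real d) * z)) / of_nat d)"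
    using exp_multisection[OF assms(1), of z] by (simp add: power_mult assms(2))
qed

lemma mittag_leffler_nonneg:
  assumes "0 < d" "0 \<le> x"
  shows "0 \<le> mittag_leffler d x"
  by (rule sums_le[OF _ sums_zero mittag_leffler_sums[OF assms(1)]]) (use assms in auto)

lemma mittag_leffler_le_exp:
  assumes "0 < d" "0 \<le> s"
  shows "mittag_leffler d (s ^ d) \<le> exp s"
proof -
  have "of_real (mittag_leffler d (s ^ d)) =
      (\<Sum>k<d. exp (cis (2 * pi * real k / real d) * of_real s)) / of_nat d"
    by (rule mittag_leffler_eq_sum_exp) (simp_all add: assms)
  then have "\<bar>mittag_leffler d (s ^ d)\<bar> =
      norm (\<Sum>k<d. exp (cis (2 * pi * real k / real d) * of_real s)) / real d"
    by (metis norm_of_real norm_divide norm_of_nat)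
  also have "\<dots> \<le> (\<Sum>k<d. exp s) / real d"
    using assms mult_right_mono[OF cos_le_one, of s]
    by (intro divide_right_mono sum_norm_le) auto
  finally show ?thesis using assms by simp
qed

lemma cos_le_cos_of_between:
  assumes "0 \<le> a" "a \<le> x" "x \<le> 2 * pi - a"
  shows "cos x \<le> cos a"
proof (cases "x \<le> pi")
  case True
  then show ?thesis using assms by (intro cos_monotone_0_pi_le) auto
next
  case False
  have "cos (2 * pi - x) \<le> cos a"
    using assms False by (intro cos_monotone_0_pi_le) auto
  then show ?thesis by (simp add: cos_diff)
qed

text \<open>The \<open>d\<close>-th roots of \<open>- (s ^ d)\<close> have the odd multiples of
  \<open>pi / d\<close> as arguments. All of them stay at angular distance at least
  \<open>pi / d\<close> from the positive axis, so their real parts are at most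
  \<open>s * cos (pi / d)\<close>.\<close>

lemma abs_mittag_leffler_neg_le:
  assumes "0 < d" "0 \<le> s"
  shows "\<bar>mittag_leffler d (- (s ^ d))\<bar> \<le> exp (s * cos (pi / real d))"
proof -
  let ?z = "of_real s * cis (pi / real d)"
  have "cis (pi / real d) ^ d = -1"
    unfolding Complex.DeMoivre using assms by simp
  then have "?z ^ d = of_real (- (s ^ d))"
    by (simp add: power_mult_distrib)
  from mittag_leffler_eq_sum_exp[OF assms(1) this]
  have "\<bar>mittag_leffler d (- (s ^ d))\<bar> =
      norm (\<Sum>k<d. exp (cis (2 * pi * real k / real d) * ?z)) / real d"
    by (metis norm_of_real norm_divide norm_of_nat)
  also have "\<dots> \<le> (\<Sum>k<d. exp (s * cos (pi / real d))) / real d"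
  proof (intro divide_right_mono sum_norm_le)
    fix k assume "k \<in> {..<d}"
    then have k: "real k + 1 \<le> real d" by auto
    have rot: "cis (2 * pi * real k / real d) * ?z = of_real s * cis ((2 * real k + 1) * pi / real d)"
      by (simp add: cis_mult mult_ac add_divide_distrib distrib_left distrib_right add.commute)
    have "cos ((2 * real k + 1) * pi / real d) \<le> cos (pi / real d)"
    proof (rule cos_le_cos_of_between)
      have "(2 * real k + 1) * pi \<le> (2 * real d - 1) * pi" using k by (intro mult_right_mono) auto
      then have "(2 * real k + 1) * pi / real d \<le> (2 * real d - 1) * pi / real d"
        by (rule divide_right_mono) simp
      also have "\<dots> = 2 * pi - pi / real d" using assms by (simp add: field_simps)
      finally show "(2 * real k + 1) * pi / real d \<le> 2 * pi - pi / real d" .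
    qed (use assms in \<open>auto simp: field_simps\<close>)
    then show "norm (exp (cis (2 * pi * real k / real d) * ?z)) \<le> exp (s * cos (pi / real d))"
      unfolding rot using assms by (simp add: mult_left_mono)
  qed auto
  finally show ?thesis using assms by simp
qed

text \<open>The root of unity 1 contributes \<open>exp s\<close>. The other \<open>d - 1\<close>
  summands have modulus at most \<open>q\<close>, and the assumption on \<open>s\<close> keeps their
  total below \<open>exp s / 2\<close>. This is the source of the \<open>eta\<close> term in
  \<open>u_const\<close>.\<close>

lemma mittag_leffler_ge:
  assumes "2 \<le> d" "0 \<le> s" "ln (2 * (real d - 1)) \<le> s * (1 - cos (2 * pi / real d))"
  shows "exp s / (2 * real d) \<le> mittag_leffler d (s ^ d)"
proof -
  let ?e = "\<lambda>k. exp (cis (2 * pi * real k / real d) * complex_of_real s)"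
  define q where "q = exp (s * cos (2 * pi / real d))"
  have "{..<d} = insert 0 {1..<d}" using assms by auto
  then have split: "(\<Sum>k<d. ?e k) = exp (of_real s) + (\<Sum>k\<in>{1..<d}. ?e k)" by simp
  have "of_real (mittag_leffler d (s ^ d)) = (\<Sum>k<d. ?e k) / of_nat d"
    by (rule mittag_leffler_eq_sum_exp) (use assms in simp_all)
  then have "of_real (real d * mittag_leffler d (s ^ d)) = of_real (exp s) + (\<Sum>k\<in>{1..<d}. ?e k)"
    using assms split by (simp add: exp_of_real)
  then have "of_real (real d * mittag_leffler d (s ^ d) - exp s) = (\<Sum>k\<in>{1..<d}. ?e k)"
    by simp
  then have "\<bar>real d * mittag_leffler d (s ^ d) - exp s\<bar> = norm (\<Sum>k\<in>{1..<d}. ?e k)"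
    by (metis norm_of_real)
  also have "\<dots> \<le> (\<Sum>k\<in>{1..<d}. q)"
  proof (rule sum_norm_le)
    fix k assume k: "k \<in> {1..<d}"
    then have "1 \<le> real k" "real k + 1 \<le> real d" by auto
    have "cos (2 * pi * real k / real d) \<le> cos (2 * pi / real d)"
    proof (rule cos_le_cos_of_between)
      have "2 * pi * (real k + 1) \<le> 2 * pi * real d"
        using \<open>real k + 1 \<le> real d\<close> by (intro mult_left_mono) auto
      then show "2 * pi * real k / real d \<le> 2 * pi - 2 * pi / real d"
        using assms by (simp add: field_simps)
    qed (use assms \<open>1 \<le> real k\<close> in \<open>auto simp: field_simps\<close>)
    then show "norm (?e k) \<le> q"
      using assms(2) by (simp add: q_def mult_left_mono mult.commute)
  qed
  also have "\<dots> = (real d - 1) * q" using assms by (simp add: of_nat_diff)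
  also have "\<dots> \<le> exp s / 2"
  proof -
    have "2 * (real d - 1) = exp (ln (2 * (real d - 1)))" using assms by simp
    also have "\<dots> \<le> exp (s * (1 - cos (2 * pi / real d)))"
      using assms(3) by (rule iffD2[OF exp_le_cancel_iff])
    finally have "2 * (real d - 1) * q \<le> exp (s * (1 - cos (2 * pi / real d))) * q"
      by (intro mult_right_mono) (simp_all add: q_def)
    also have "\<dots> = exp s" by (simp add: q_def exp_add[symmetric] algebra_simps)
    finally show ?thesis by (simp add: algebra_simps)
  qed
  finally have "exp s / 2 \<le> real d * mittag_leffler d (s ^ d)" by linarith
  then show ?thesis using assms by (simp add: field_simps)
qed

section \<open>The test function\<close>

text \<open>The difference of squares is twice the odd part of the squared function, so its Taylor
  coefficients are nonnegative. For \<open>d \<ge> 2\<close> and \<open>u \<ge> 0\<close> the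
  divisor bounds the squared function on \<open>[-1, 0]\<close>, where the quotient in
  \<open>test_den\<close> is therefore at most 1.\<close>

definition test_num :: "nat \<Rightarrow> real \<Rightarrow> real \<Rightarrow> real" where
  "test_num d u z = ((mittag_leffler d (u ^ d * z))\<^sup>2 - (mittag_leffler d (- (u ^ d * z)))\<^sup>2)
     / exp (2 * u * cos (pi / real d))"

definition test_den :: "nat \<Rightarrow> real \<Rightarrow> real \<Rightarrow> real" where
  "test_den d u z = 1 + (mittag_leffler d (u ^ d * z))\<^sup>2 / exp (2 * u * cos (pi / real d))"

lemma test_den_ge_1: "1 \<le> test_den d u z"
  by (simp add: test_den_def)

lemma test_num_le_den: "test_num d u z \<le> test_den d u z"
  by (simp add: test_num_def test_den_def diff_divide_distrib add_increasing)

lemma cos_pi_div_nonneg: "2 \<le> d \<Longrightarrow> 0 \<le> cos (pi / real d)"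
  by (rule cos_ge_zero) (auto simp: field_simps intro: order_trans[of _ 0])

lemma powr_inverse_power: "0 < d \<Longrightarrow> 0 \<le> z \<Longrightarrow> (z powr (1 / real d)) ^ d = z"
  by (cases "z = 0") (simp_all add: powr_realpow[symmetric] powr_powr)

text \<open>For \<open>z \<ge> 0\<close> the growth is at most \<open>exp (2 * s)\<close> with
  \<open>s = u * z powr (1 / d)\<close>. For \<open>-1 \<le> z < 0\<close> the divisor in
  \<open>test_den\<close> absorbs the squared value entirely.\<close>

lemma test_den_le:
  assumes "2 \<le> d" "0 \<le> u" "-1 \<le> z"
  defines "\<tau> \<equiv> exp (2 * u * (z + 1) powr (1 / real d))"
  shows "test_den d u z - 1 \<le> \<tau>"
proof -
  define c where "c = cos (pi / real d)"
  have c: "0 \<le> c" using cos_pi_div_nonneg[OF assms(1)] by (simp add: c_def)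
  have "(mittag_leffler d (u ^ d * z))\<^sup>2 \<le> exp (2 * u * c) * \<tau>"
  proof (cases "0 \<le> z")
    case True
    define s where "s = u * z powr (1 / real d)"
    have s: "0 \<le> s" "s ^ d = u ^ d * z"
      using assms True by (simp_all add: s_def power_mult_distrib powr_inverse_power)
    have "(mittag_leffler d (u ^ d * z))\<^sup>2 \<le> (exp s)\<^sup>2"
      using mittag_leffler_le_exp[of d s] mittag_leffler_nonneg[of d "u ^ d * z"] s assms True
      by (intro power_mono) auto
    also have "\<dots> = exp (2 * s)" by (simp add: exp_double)
    also have "\<dots> \<le> \<tau>"
      using assms True unfolding \<tau>_def s_def by (auto intro!: mult_left_mono powr_mono2)
    also have "\<dots> \<le> exp (2 * u * c) * \<tau>"
      using assms(2) c by (simp add: \<tau>_def)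
    finally show ?thesis .
  next
    case False
    define s where "s = u * (- z) powr (1 / real d)"
    have s: "0 \<le> s" "- (s ^ d) = u ^ d * z"
      using assms False by (simp_all add: s_def power_mult_distrib powr_inverse_power)
    have "(- z) powr (1 / real d) \<le> 1 powr (1 / real d)"
      using assms False by (intro powr_mono2) auto
    then have su: "s \<le> u" using assms(2) by (simp add: s_def mult_left_le)
    have "\<bar>mittag_leffler d (u ^ d * z)\<bar>\<^sup>2 \<le> (exp (s * c))\<^sup>2"
      using abs_mittag_leffler_neg_le[of d s] s assms
      by (intro power_mono) (auto simp: c_def)
    also have "\<dots> = exp (2 * s * c)" by (simp add: exp_double[symmetric] mult_ac)
    also have "\<dots> \<le> exp (2 * u * c)" using su c by (simp add: mult_right_mono)
    also have "\<dots> \<le> exp (2 * u * c) * \<tau>" using assms by (simp add: \<tau>_def)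
    finally show ?thesis by simp
  qed
  then show ?thesis by (simp add: test_den_def c_def field_simps)
qed

text \<open>For \<open>z < -1\<close> the ratio of \<open>E\<^sup>2\<close> at \<open>-u\<^sup>d z\<close> and \<open>u\<^sup>d z\<close> is at least
  \<open>exp (2 * u * gam d) / (4 * d\<^sup>2)\<close>.\<close>

lemma test_num_le_neg:
  assumes "2 \<le> d" "0 \<le> u" "1 \<le> r" "z < -1"
    and "ln (2 * (real d - 1)) \<le> u * eta d" "ln (24 * real d ^ 2 * r) \<le> 2 * u * gam d"
  shows "test_num d u z \<le> (1 - 3 * r) * test_den d u z"
proof -
  define c where "c = cos (pi / real d)"
  define s where "s = u * (- z) powr (1 / real d)"
  define P where "P = (mittag_leffler d (- (u ^ d * z)))\<^sup>2"
  define N where "N = (mittag_leffler d (u ^ d * z))\<^sup>2"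
  have s: "s ^ d = - (u ^ d * z)"
    using assms by (simp_all add: s_def power_mult_distrib powr_inverse_power)
  have "1 powr (1 / real d) \<le> (- z) powr (1 / real d)"
    using assms by (intro powr_mono2) auto
  then have su: "u \<le> s" using mult_left_mono[of 1 "(- z) powr (1 / real d)" u] assms(2) by (simp add: s_def)
  have c: "0 \<le> c" "c \<le> 1" using cos_pi_div_nonneg[OF assms(1)] by (simp_all add: c_def)
  have eta: "0 \<le> eta d" and gam: "gam d = 1 - c"
    by (simp_all add: eta_def gam_def c_def theta_def)
  have "N \<le> (exp (s * c))\<^sup>2"
    using abs_mittag_leffler_neg_le[of d s] s assms su
      power_mono[of "\<bar>mittag_leffler d (u ^ d * z)\<bar>" "exp (s * c)" 2]
    by (simp add: c_def N_def)
  then have N: "N \<le> exp (2 * s * c)" by (simp add: exp_double[symmetric] mult_ac)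
  have "u * eta d \<le> s * eta d" using su eta by (rule mult_right_mono)
  then have "exp s / (2 * real d) \<le> mittag_leffler d (s ^ d)"
    using assms su by (intro mittag_leffler_ge) (auto simp: eta_def theta_def)
  then have "(exp s / (2 * real d))\<^sup>2 \<le> P"
    unfolding P_def s by (intro power_mono) auto
  then have "(exp s)\<^sup>2 \<le> 4 * real d ^ 2 * P"
    using assms by (simp add: power_divide power_mult_distrib field_simps)
  then have "exp (2 * s) \<le> 4 * real d ^ 2 * P"
    by (simp only: exp_double)
  \<comment> \<open>The constant 24 splits as \<open>4 * 6\<close>: the factor
    \<open>4 * d ^ 2\<close> is lost in squaring \<open>mittag_leffler_ge\<close>, and
    \<open>6 * r\<close> is \<open>3 * r\<close> times the 2 from bounding both
    \<open>exp (2 * u * c)\<close> and \<open>N\<close> by \<open>exp (2 * s * c)\<close>.\<close>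
  moreover have "24 * real d ^ 2 * r * exp (2 * s * c) \<le> exp (2 * s)"
  proof -
    have "24 * real d ^ 2 * r = exp (ln (24 * real d ^ 2 * r))" using assms by simp
    also have "\<dots> \<le> exp (2 * s * (1 - c))"
      using assms(6) su c mult_right_mono[of u s "1 - c"] by (simp add: gam)
    finally have "24 * real d ^ 2 * r * exp (2 * s * c) \<le> exp (2 * s * (1 - c)) * exp (2 * s * c)"
      by (rule mult_right_mono) simp
    then show ?thesis by (simp add: exp_add[symmetric] algebra_simps)
  qed
  ultimately have "4 * real d ^ 2 * (6 * r * exp (2 * s * c)) \<le> 4 * real d ^ 2 * P" by linarith
  then have P: "6 * r * exp (2 * s * c) \<le> P" using assms by simp
  have "exp (2 * u * c) \<le> exp (2 * s * c)" using su c by (simp add: mult_right_mono)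
  then have "exp (2 * u * c) + N \<le> 2 * exp (2 * s * c)" using N by linarith
  then have "3 * r * (exp (2 * u * c) + N) \<le> 3 * r * (2 * exp (2 * s * c))"
    using assms(3) by (intro mult_left_mono) auto
  then have "3 * r * (exp (2 * u * c) + N) \<le> P" using P by simp
  then have "N - P \<le> (1 - 3 * r) * (exp (2 * u * c) + N)"
    unfolding left_diff_distrib mult_1 using exp_gt_zero[of "2 * u * c"] by linarith
  then have "(N - P) / exp (2 * u * c) \<le> (1 - 3 * r) * (exp (2 * u * c) + N) / exp (2 * u * c)"
    by (rule divide_right_mono) simp
  moreover have "test_num d u z = (N - P) / exp (2 * u * c)"
    by (simp add: test_num_def N_def P_def c_def)
  moreover have "test_den d u z = (exp (2 * u * c) + N) / exp (2 * u * c)"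
    by (simp add: test_den_def N_def c_def add_divide_distrib)
  ultimately show ?thesis by (simp only: times_divide_eq_right)
qed

definition test_fun :: "nat \<Rightarrow> nat \<Rightarrow> real \<Rightarrow> (nat \<Rightarrow> real) \<Rightarrow> real" where
  "test_fun r d u z = (\<Sum>j\<in>{1..r}. test_num d u (z j) * (\<Prod>i\<in>{1..r} - {j}. test_den d u (z i)))"

text \<open>Factor out the product of all \<open>test_den\<close>, which is at least 1. The ratio at
  \<open>k\<close> is at most \<open>1 - 3 * r\<close> and the other \<open>r - 1\<close> ratios are
  at most 1, so they sum to at most \<open>- 2 * r\<close>.\<close>

lemma test_fun_le_neg:
  assumes "2 \<le> d" "0 \<le> u" "k \<in> {1..r}" "z k < -1"
    and "ln (2 * (real d - 1)) \<le> u * eta d" "ln (24 * real d ^ 2 * real r) \<le> 2 * u * gam d"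
  shows "test_fun r d u z \<le> - real r"
proof -
  let ?N = "\<lambda>j. test_num d u (z j)" and ?D = "\<lambda>j. test_den d u (z j)"
  have D: "0 < ?D j" for j using test_den_ge_1[of d u "z j"] by linarith
  have "test_fun r d u z = (\<Sum>j\<in>{1..r}. ?N j / ?D j * (\<Prod>i\<in>{1..r}. ?D i))"
    unfolding test_fun_def
  proof (intro sum.cong refl)
    fix j assume "j \<in> {1..r}"
    then have "(\<Prod>i\<in>{1..r}. ?D i) = ?D j * (\<Prod>i\<in>{1..r} - {j}. ?D i)"
      by (intro prod.remove) auto
    then show "?N j * (\<Prod>i\<in>{1..r} - {j}. ?D i) = ?N j / ?D j * (\<Prod>i\<in>{1..r}. ?D i)"
      using D[of j] by simp
  qed
  also have "\<dots> = (\<Sum>j\<in>{1..r}. ?N j / ?D j) * (\<Prod>i\<in>{1..r}. ?D i)"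
    by (simp add: sum_distrib_right)
  also have "\<dots> \<le> - real r * (\<Prod>i\<in>{1..r}. ?D i)"
  proof (rule mult_right_mono)
    have "(\<Sum>j\<in>{1..r}. ?N j / ?D j) = ?N k / ?D k + (\<Sum>j\<in>{1..r} - {k}. ?N j / ?D j)"
      using assms by (intro sum.remove) auto
    moreover have "?N k / ?D k \<le> 1 - 3 * real r"
      using test_num_le_neg[of d u "real r" "z k"] D[of k] assms by (simp add: divide_le_eq)
    moreover have "(\<Sum>j\<in>{1..r} - {k}. ?N j / ?D j) \<le> (\<Sum>j\<in>{1..r} - {k}. 1)"
      using D by (intro sum_mono) (simp add: test_num_le_den divide_le_eq)
    moreover have "(\<Sum>j\<in>{1..r} - {k}. 1 :: real) = real r - 1"
      using assms by (simp add: of_nat_diff)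
    ultimately show "(\<Sum>j\<in>{1..r}. ?N j / ?D j) \<le> - real r" by linarith
  qed (rule prod_nonneg, use D in \<open>simp add: less_imp_le\<close>)
  also have "\<dots> \<le> - real r * 1"
    by (intro mult_left_mono_neg prod_ge_1 test_den_ge_1) auto
  finally show ?thesis by simp
qed

text \<open>Every \<open>test_num\<close> is at most \<open>\<tau>\<close> and every
  \<open>test_den\<close> at most \<open>1 + \<tau> \<le> 2 * \<tau>\<close>. The \<open>r\<close>
  summands thus give \<open>r * 2 ^ (r - 1) * \<tau> ^ r\<close>, which is where
  \<open>D_const\<close> comes from.\<close>

lemma test_fun_le:
  assumes "2 \<le> d" "0 \<le> u" "\<And>i. i \<in> {1..r} \<Longrightarrow> -1 \<le> z i"
    and "\<And>i. i \<in> {1..r} \<Longrightarrow> (z i + 1) powr (1 / real d) \<le> t"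
  shows "test_fun r d u z \<le> D_const r * exp (2 * real r * u * t)"
proof -
  define \<tau> where "\<tau> = exp (2 * u * t)"
  have \<tau>: "test_den d u (z i) - 1 \<le> \<tau> \<and> 1 \<le> \<tau>" if "i \<in> {1..r}" for i
  proof -
    have "0 \<le> t" using assms(4)[OF that] powr_ge_zero order_trans by blast
    then have "1 \<le> \<tau>" using assms(2) by (simp add: \<tau>_def)
    moreover have "test_den d u (z i) - 1 \<le> exp (2 * u * (z i + 1) powr (1 / real d))"
      using assms(1,2) assms(3)[OF that] by (rule test_den_le)
    moreover have "\<dots> \<le> \<tau>"
      using assms(2) assms(4)[OF that] by (simp add: \<tau>_def mult_left_mono)
    ultimately show ?thesis by linarith
  qed
  have "test_num d u (z j) * (\<Prod>i\<in>{1..r} - {j}. test_den d u (z i)) \<le> 2 ^ (r - 1) * \<tau> ^ r"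
    if j: "j \<in> {1..r}" for j
  proof -
    have "test_num d u (z j) \<le> test_den d u (z j) - 1"
      by (simp add: test_num_def test_den_def divide_right_mono)
    then have "test_num d u (z j) \<le> \<tau>" using \<tau>[OF j] by linarith
    moreover have "(\<Prod>i\<in>{1..r} - {j}. test_den d u (z i)) \<le> (\<Prod>i\<in>{1..r} - {j}. 2 * \<tau>)"
      using \<tau> test_den_ge_1[of d u] by (intro prod_mono) (force intro: order_trans[of 0 1])
    moreover have "0 \<le> (\<Prod>i\<in>{1..r} - {j}. test_den d u (z i))"
      using test_den_ge_1[of d u] by (intro prod_nonneg) (auto intro: order_trans[of 0 1])
    ultimately have "test_num d u (z j) * (\<Prod>i\<in>{1..r} - {j}. test_den d u (z i))
        \<le> \<tau> * (2 * \<tau>) ^ (r - 1)"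
      using j by (intro mult_mono) (auto simp: \<tau>_def)
    also have "\<dots> = 2 ^ (r - 1) * \<tau> ^ Suc (r - 1)" by (simp add: power_mult_distrib)
    also have "Suc (r - 1) = r" using j by simp
    finally show ?thesis .
  qed
  then have "test_fun r d u z \<le> (\<Sum>j\<in>{1..r}. 2 ^ (r - 1) * \<tau> ^ r)"
    unfolding test_fun_def by (rule sum_mono)
  also have "\<dots> = D_const r * exp (2 * real r * u * t)"
    by (simp add: D_const_def \<tau>_def exp_of_nat_mult[symmetric] mult_ac)
  finally show ?thesis .
qed

text \<open>The numerator factors into the sum and the difference of the values at
  \<open>u ^ d * z\<close> and its negative. Their coefficients carry the factors
  \<open>1 + (-1) ^ n\<close> and \<open>1 - (-1) ^ n\<close>, which are never negative.\<close>

lemma psd_kernel_test_fun: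
  assumes X: "finite X" and K: "\<And>i. i \<in> {1..r} \<Longrightarrow> psd_kernel X (K i)"
    and d: "0 < d" and u: "0 \<le> u"
  shows "psd_kernel X (\<lambda>x y. test_fun r d u (\<lambda>i. K i x y))"
proof -
  let ?E = "mittag_leffler d"
  define c where "c = 1 / exp (2 * u * cos (pi / real d))"
  have E: "(\<lambda>n. x ^ n / fact (d * n)) sums ?E x" for x
    by (rule mittag_leffler_sums[OF d])
  have E_minus: "(\<lambda>n. (-1) ^ n * x ^ n / fact (d * n)) sums ?E (- x)" for x
    using E[of "- x"] by (subst (asm) power_minus)
  have uK: "psd_kernel X (\<lambda>x y. u ^ d * K i x y)" if "i \<in> {1..r}" for i
    using X u K[OF that] by (intro psd_kernel_cmult) auto
  have plus: "psd_kernel X (\<lambda>x y. ?E (u ^ d * K i x y))" if "i \<in> {1..r}" for i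
    using E by (intro psd_kernel_power_series[OF X uK[OF that], where a = "\<lambda>n. 1 / fact (d * n)"]) auto
  have even: "psd_kernel X (\<lambda>x y. ?E (u ^ d * K i x y) + ?E (- (u ^ d * K i x y)))"
    if "i \<in> {1..r}" for i
  proof (rule psd_kernel_power_series[OF X uK[OF that], where a = "\<lambda>n. (1 + (-1) ^ n) / fact (d * n)"])
    show "(\<lambda>n. (1 + (-1) ^ n) / fact (d * n) * (u ^ d * K i x y) ^ n) sums
        (?E (u ^ d * K i x y) + ?E (- (u ^ d * K i x y)))" for x y
      using sums_add[OF E[of "u ^ d * K i x y"] E_minus[of "u ^ d * K i x y"]]
      by (simp add: add_divide_distrib algebra_simps)
    show "0 \<le> (1 + (-1) ^ n) / (fact (d * n) :: real)" for n by (cases "even n") auto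
  qed
  have odd: "psd_kernel X (\<lambda>x y. ?E (u ^ d * K i x y) - ?E (- (u ^ d * K i x y)))"
    if "i \<in> {1..r}" for i
  proof (rule psd_kernel_power_series[OF X uK[OF that], where a = "\<lambda>n. (1 - (-1) ^ n) / fact (d * n)"])
    show "(\<lambda>n. (1 - (-1) ^ n) / fact (d * n) * (u ^ d * K i x y) ^ n) sums
        (?E (u ^ d * K i x y) - ?E (- (u ^ d * K i x y)))" for x y
      using sums_diff[OF E[of "u ^ d * K i x y"] E_minus[of "u ^ d * K i x y"]]
      by (simp add: diff_divide_distrib algebra_simps)
    show "0 \<le> (1 - (-1) ^ n) / (fact (d * n) :: real)" for n by (cases "even n") auto
  qed
  have num: "psd_kernel X (\<lambda>x y. test_num d u (K i x y))" if i: "i \<in> {1..r}" for i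
  proof -
    have "psd_kernel X (\<lambda>x y. c * ((?E (u ^ d * K i x y) + ?E (- (u ^ d * K i x y))) *
        (?E (u ^ d * K i x y) - ?E (- (u ^ d * K i x y)))))"
      using X i by (intro psd_kernel_cmult psd_kernel_mult even odd) (auto simp: c_def)
    then show ?thesis
      by (rule psd_kernel_cong) (simp add: test_num_def c_def power2_eq_square square_diff_square_factored)
  qed
  have den: "psd_kernel X (\<lambda>x y. test_den d u (K i x y))" if i: "i \<in> {1..r}" for i
  proof -
    have "psd_kernel X (\<lambda>x y. 1 + c * ?E (u ^ d * K i x y) ^ 2)"
      using X i by (intro psd_kernel_add psd_kernel_const psd_kernel_cmult psd_kernel_power plus)
        (auto simp: c_def)
    then show ?thesis
      by (rule psd_kernel_cong) (simp add: test_den_def c_def)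
  qed
  show ?thesis
    unfolding test_fun_def using X
    by (intro psd_kernel_sum psd_kernel_mult psd_kernel_prod num den) auto
qed

section \<open>Large values of kernels\<close>

text \<open>Telescoping: removing the atom \<open>p x\<close> with least \<open>T x\<close> lowers \<open>2 * sqrt (B * sum p A)\<close> by at
  least \<open>p x * sqrt (B / sum p A)\<close>.\<close>

lemma sum_exp_le_of_tail:
  fixes p T :: "'a \<Rightarrow> real"
  assumes "finite A" "0 \<le> B" "\<And>x. x \<in> A \<Longrightarrow> 0 \<le> p x"
    and "\<And>x. x \<in> A \<Longrightarrow> (\<Sum>y | y \<in> A \<and> T x \<le> T y. p y) \<le> B * exp (- (2 * \<kappa> * T x))"
  shows "(\<Sum>x\<in>A. p x * exp (\<kappa> * T x)) \<le> 2 * sqrt (B * sum p A)"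
  using assms(1,3,4)
proof (induction A rule: finite_ranking_induct[where f = "\<lambda>x. - T x"])
  case (insert x A)
  show ?case
  \<comment> \<open>The ranking induction adds points in order of nonincreasing \<open>T\<close>,
    but allows the new point to be present already.\<close>
  proof (cases "x \<in> A")
    case True
    then show ?thesis using insert by (simp add: insert_absorb)
  next
    case False
    let ?S = "sum p A"
    have pos: "0 \<le> ?S" "0 \<le> p x" using insert.prems by (auto intro: sum_nonneg)
    have "(\<Sum>y\<in>A. p y * exp (\<kappa> * T y)) \<le> 2 * sqrt (B * ?S)"
    proof (rule insert.IH)
      fix y assume y: "y \<in> A"
      have "(\<Sum>z | z \<in> A \<and> T y \<le> T z. p z) \<le> (\<Sum>z | z \<in> insert x A \<and> T y \<le> T z. p z)"
        using insert by (intro sum_mono2) auto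
      also have "\<dots> \<le> B * exp (- (2 * \<kappa> * T y))" using insert.prems(2) y by blast
      finally show "(\<Sum>z | z \<in> A \<and> T y \<le> T z. p z) \<le> B * exp (- (2 * \<kappa> * T y))" .
    qed (use insert.prems in auto)
    moreover have "p x * exp (\<kappa> * T x) + 2 * sqrt (B * ?S) \<le> 2 * sqrt (B * (p x + ?S))"
    proof -
      \<comment> \<open>This is the discrete form of integrating \<open>sqrt (B / s)\<close> from
        \<open>?S\<close> to \<open>p x + ?S\<close>. Since \<open>x\<close> is minimal, its tail is
        the whole current sum, so the tail bound reads \<open>a * e \<le> sqrt B\<close>.\<close>
      define a b e where "a = sqrt (p x + ?S)" and "b = sqrt ?S" and "e = exp (\<kappa> * T x)"
      have ab: "0 \<le> b" "b \<le> a" "a\<^sup>2 = p x + ?S" "b\<^sup>2 = ?S" "0 < e"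
        using pos by (auto simp: a_def b_def e_def)
      have "{y \<in> insert x A. T x \<le> T y} = insert x A"
        using insert.hyps by auto
      then have "p x + ?S \<le> B * exp (- (2 * \<kappa> * T x))"
        using insert.prems(2)[of x] insert.hyps False by simp
      also have "exp (- (2 * \<kappa> * T x)) = 1 / e\<^sup>2"
        using exp_double[of "\<kappa> * T x"]
        by (simp add: e_def exp_minus divide_inverse mult.assoc)
      finally have "(a * e)\<^sup>2 \<le> B"
        using ab by (simp add: power_mult_distrib field_simps)
      then have ae: "a * e \<le> sqrt B" by (rule real_le_rsqrt)
      have "p x * e = (a - b) * (a + b) * e"
        using ab by (simp add: algebra_simps power2_eq_square)
      also have "\<dots> \<le> (a - b) * (2 * a) * e"
        using ab by (intro mult_right_mono mult_left_mono) auto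
      also have "\<dots> = 2 * (a - b) * (a * e)" by simp
      also have "\<dots> \<le> 2 * (a - b) * sqrt B"
        using ab ae by (intro mult_left_mono) auto
      finally have "p x * e + 2 * (sqrt B * b) \<le> 2 * (sqrt B * a)"
        by (simp add: algebra_simps)
      then show ?thesis unfolding a_def b_def e_def real_sqrt_mult .
    qed
    ultimately show ?thesis using insert.hyps False by simp
  qed
qed simp

section \<open>Quadratic lower bounds for \<open>eta\<close> and \<open>gam\<close>\<close>

lemma one_minus_cos_ge:
  assumes "0 \<le> t" "t \<le> pi"
  shows "2 * t\<^sup>2 / pi\<^sup>2 \<le> 1 - cos t"
proof -
  \<comment> \<open>Concavity puts the sine above its chord on this interval (Jordan's inequality);
    the half-angle formula then turns this into the claim.\<close>
  have "concave_on {0..pi/2} sin"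
    by (rule f''_le0_imp_concave[where f' = cos and f'' = "\<lambda>x. - sin x"])
       (auto intro!: derivative_eq_intros sin_ge_zero)
  from concave_onD_Icc'[OF this, of "t/2"] have "t / pi \<le> sin (t / 2)"
    using assms by simp
  then have "(t / pi)\<^sup>2 \<le> (sin (t / 2))\<^sup>2"
    using assms by (intro power_mono) auto
  moreover have "cos t = 1 - 2 * (sin (t / 2))\<^sup>2"
    using cos_double_sin[of "t/2"] by simp
  ultimately show ?thesis by (simp add: power_divide)
qed

lemma u_const_ge:
  shows "1 \<le> u_const r d" "ln (2 * (real d - 1)) / eta d \<le> u_const r d"
    "ln (24 * real d ^ 2 * real r) / (2 * gam d) \<le> u_const r d"
  by (simp_all add: u_const_def)

lemma eta_ge:
  assumes "2 \<le> d"
  shows "8 / real d ^ 2 \<le> eta d"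
  using one_minus_cos_ge[of "2 * pi / real d"] assms
  by (simp add: eta_def theta_def power_divide power_mult_distrib field_simps)

lemma gam_ge:
  assumes "1 \<le> d"
  shows "2 / real d ^ 2 \<le> gam d"
  using one_minus_cos_ge[of "pi / real d"] assms
  by (simp add: gam_def theta_def power_divide field_simps)

text \<open>Finite form of the result: the common law becomes a weight vector \<open>p\<close>, and
  arbitrary positive semidefinite kernels replace the inner products.\<close>

theorem psd_kernels_large_values:
  fixes p :: "'x \<Rightarrow> real"
  assumes r: "2 \<le> r" and d: "2 \<le> d" and X: "finite X"
    and p: "\<And>x. x \<in> X \<Longrightarrow> 0 \<le> p x" "sum p X = 1"
    and K: "\<And>i. i \<in> {1..r} \<Longrightarrow> psd_kernel X (K i)"
  shows "\<exists>i\<in>{1..r}. \<exists>l\<ge>-1. beta r * exp (- C_const r d * (l + 1) powr (1 / real d)) \<le>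
    (\<Sum>(x, y) | x \<in> X \<and> y \<in> X \<and> l \<le> K i x y \<and> (\<forall>j\<in>{1..r}. j \<noteq> i \<longrightarrow> -1 \<le> K j x y). p x * p y)"
proof (rule ccontr)
  define q where "q = (\<lambda>(x, y). p x * p y)"
  define k where "k = (\<lambda>i (x, y). K i x y)"
  define S where "S i l = {w \<in> X \<times> X. l \<le> k i w \<and> (\<forall>j\<in>{1..r}. j \<noteq> i \<longrightarrow> -1 \<le> k j w)}" for i l
  assume "\<not> ?thesis"
  moreover have "(\<Sum>(x, y) | x \<in> X \<and> y \<in> X \<and> l \<le> K i x y \<and>
      (\<forall>j\<in>{1..r}. j \<noteq> i \<longrightarrow> -1 \<le> K j x y). p x * p y) = sum q (S i l)" for i l
    unfolding q_def S_def k_def by (intro sum.cong) auto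
  ultimately have small: "sum q (S i l) < beta r * exp (- C_const r d * (l + 1) powr (1 / real d))"
    if "i \<in> {1..r}" "-1 \<le> l" for i l
    using that by force
  define u where "u = u_const r d"
  have "0 < 8 / real d ^ 2" "0 < 2 / real d ^ 2" using d by simp_all
  then have "0 < eta d" "0 < gam d"
    using eta_ge[of d] gam_ge[of d] d by linarith+
  then have u: "1 \<le> u" "ln (2 * (real d - 1)) \<le> u * eta d"
      "ln (24 * real d ^ 2 * real r) \<le> 2 * u * gam d"
    using u_const_ge[where r = r and d = d] by (simp_all add: u_def divide_le_eq mult_ac)
  \<comment> \<open>\<open>\<kappa>\<close> is the growth rate in \<open>test_fun_le\<close>. The
    assumed failure gives tails of rate \<open>C_const r d = 2 * \<kappa>\<close>, exactly what
    \<open>sum_exp_le_of_tail\<close> requires.\<close>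
  define \<kappa> where "\<kappa> = 2 * real r * u"
  have C: "C_const r d = 2 * \<kappa>" by (simp add: C_const_def \<kappa>_def u_def)
  define W where "W = X \<times> X"
  have W: "finite W" and q: "\<And>w. w \<in> W \<Longrightarrow> 0 \<le> q w"
    using X p by (auto simp: W_def q_def)
  have sum_q: "sum q W = 1"
    using p(2) by (simp add: W_def q_def sum_product[symmetric] flip: sum.cartesian_product)
  define G where "G = {w \<in> W. \<forall>i\<in>{1..r}. -1 \<le> k i w}"
  define T where "T w = Max ((\<lambda>i. (k i w + 1) powr (1 / real d)) ` {1..r})" for w
  have T_ge: "(k i w + 1) powr (1 / real d) \<le> T w" if "i \<in> {1..r}" for i w
    unfolding T_def using that by (intro Max_ge) auto
  have T_nonneg: "0 \<le> T w" for w
    using T_ge[of 1 w] r by (meson atLeastAtMost_iff le_refl order_trans powr_ge_zero one_le_numeral)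
  define B where "B = real r * beta r"
  \<comment> \<open>On \<open>G\<close>, \<open>t \<le> T w\<close> forces some
    \<open>k i w \<ge> t ^ d - 1\<close>. The level \<open>l = t ^ d - 1\<close> satisfies
    \<open>(l + 1) powr (1 / d) = t\<close>, and the union bound over \<open>i\<close> costs the
    factor \<open>r\<close> in \<open>B\<close>.\<close>
  have tail: "(\<Sum>w | w \<in> G \<and> t \<le> T w. q w) \<le> B * exp (- (2 * \<kappa> * t))" if t: "0 \<le> t" for t
  proof -
    have powr_t: "(t ^ d) powr (1 / real d) = t"
      using t d by (cases "t = 0") (simp_all add: powr_realpow[symmetric] powr_powr)
    have "{w \<in> G. t \<le> T w} \<subseteq> (\<Union>i\<in>{1..r}. S i (t ^ d - 1))"
    proof
      fix w assume w: "w \<in> {w \<in> G. t \<le> T w}"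
      have "T w \<in> (\<lambda>i. (k i w + 1) powr (1 / real d)) ` {1..r}"
        unfolding T_def using r by (intro Max_in) auto
      then obtain i where i: "i \<in> {1..r}" "t \<le> (k i w + 1) powr (1 / real d)"
        using w by auto
      have "-1 \<le> k i w" using w i(1) unfolding G_def by blast
      then have k1: "0 \<le> k i w + 1" by simp
      have "t ^ d \<le> ((k i w + 1) powr (1 / real d)) ^ d"
        using i(2) t by (rule power_mono)
      then have "t ^ d - 1 \<le> k i w" using k1 d by (simp add: powr_inverse_power)
      then show "w \<in> (\<Union>i\<in>{1..r}. S i (t ^ d - 1))"
        using w i(1) by (auto simp: S_def G_def W_def)
    qed
    moreover have S: "finite (S i l)" "\<And>w. w \<in> S i l \<Longrightarrow> 0 \<le> q w" for i l
      using W q by (auto simp: S_def W_def)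
    ultimately have "(\<Sum>w | w \<in> G \<and> t \<le> T w. q w) \<le> sum q (\<Union>i\<in>{1..r}. S i (t ^ d - 1))"
      by (intro sum_mono2) auto
    also have "\<dots> \<le> (\<Sum>i\<in>{1..r}. sum q (S i (t ^ d - 1)))"
    proof -
      have "sum q (\<Union>i\<in>I. S i (t ^ d - 1)) \<le> (\<Sum>i\<in>I. sum q (S i (t ^ d - 1)))" if "finite I" for I
        using that
      proof induction
        case (insert i I)
        have "sum q (S i (t ^ d - 1) \<union> (\<Union>i\<in>I. S i (t ^ d - 1)))
            \<le> sum q (S i (t ^ d - 1)) + sum q (\<Union>i\<in>I. S i (t ^ d - 1))"
          using insert.hyps S by (subst sum_Un) (auto intro!: sum_nonneg)
        then show ?case using insert by simp
      qed simp
      then show ?thesis by simp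
    qed
    also have "\<dots> \<le> (\<Sum>i\<in>{1..r}. beta r * exp (- (2 * \<kappa> * t)))"
      using small[of _ "t ^ d - 1"] t
      by (intro sum_mono) (simp add: C powr_t less_imp_le)
    finally show ?thesis by (simp add: B_def)
  qed
  \<comment> \<open>\<open>beta\<close> is chosen so that \<open>D_const r * (2 * B)\<close> equals
    \<open>r / (2 * (r + 1))\<close>.\<close>
  have beta: "0 \<le> B" "D_const r * (2 * B) \<le> 1 / 2" "B \<le> 1 / 2"
  proof -
    have "1 \<le> D_const r"
      using r mult_mono[of 1 "real r" 1 "2 ^ (r - 1)"] by (simp add: D_const_def)
    show "0 \<le> B" by (simp add: B_def beta_def D_const_def)
    have "D_const r * (2 * B) = (D_const r / D_const r) * (real r / (2 * (real r + 1)))"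
      by (simp add: B_def beta_def)
    also have "\<dots> = real r / (2 * (real r + 1))" using \<open>1 \<le> D_const r\<close> by simp
    also have "\<dots> \<le> 1 / 2" by (simp add: divide_le_eq)
    finally show "D_const r * (2 * B) \<le> 1 / 2" .
    moreover have "1 * (2 * B) \<le> D_const r * (2 * B)"
      using \<open>0 \<le> B\<close> \<open>1 \<le> D_const r\<close> by (intro mult_right_mono) auto
    ultimately show "B \<le> 1 / 2" using \<open>0 \<le> B\<close> by linarith
  qed
  have G: "finite G" "G \<subseteq> W" using W by (auto simp: G_def)
  \<comment> \<open>The tail bound at \<open>t = 0\<close> already limits the mass of
    \<open>G\<close> to \<open>B\<close>; this turns the square-root bound below into
    \<open>2 * B\<close>.\<close>
  have "{w \<in> G. 0 \<le> T w} = G" using T_nonneg by auto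
  then have sum_G: "sum q G \<le> B" using tail[of 0] by simp
  have "(\<Sum>w\<in>G. q w * exp (\<kappa> * T w)) \<le> 2 * sqrt (B * sum q G)"
    using G q T_nonneg beta tail by (intro sum_exp_le_of_tail) auto
  also have "\<dots> \<le> 2 * sqrt (B * B)"
    using sum_G beta by (intro mult_left_mono real_sqrt_le_mono) auto
  finally have exp_G: "(\<Sum>w\<in>G. q w * exp (\<kappa> * T w)) \<le> 2 * B" using beta by simp
  define F where "F w = test_fun r d u (\<lambda>i. k i w)" for w
  have "psd_kernel X (\<lambda>x y. F (x, y))"
    unfolding F_def k_def split using X K d u by (intro psd_kernel_test_fun) auto
  \<comment> \<open>Taking the weights themselves as coefficients makes the quadratic form the
    expectation of \<open>F\<close>.\<close>
  from psd_kernel_nonneg[OF this, of p]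
  have "0 \<le> (\<Sum>w\<in>W. q w * F w)"
    by (simp add: W_def q_def sum.cartesian_product split_def)
  also have "\<dots> = (\<Sum>w\<in>W - G. q w * F w) + (\<Sum>w\<in>G. q w * F w)"
    using W G by (intro sum.subset_diff)
  also have "(\<Sum>w\<in>W - G. q w * F w) \<le> (\<Sum>w\<in>W - G. q w * (- real r))"
  proof (intro sum_mono mult_left_mono q)
    fix w assume "w \<in> W - G"
    then obtain i where "i \<in> {1..r}" "k i w < -1" by (force simp: G_def)
    then show "F w \<le> - real r"
      unfolding F_def using d u by (intro test_fun_le_neg) auto
  qed auto
  also have "\<dots> = - real r * (1 - sum q G)"
    using sum_diff[OF W G(2), of q] sum_q
    unfolding sum_distrib_right[symmetric] by (simp add: mult.commute)
  also have "(\<Sum>w\<in>G. q w * F w) \<le> (\<Sum>w\<in>G. q w * (D_const r * exp (\<kappa> * T w)))"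
  proof (intro sum_mono mult_left_mono q)
    show "F w \<le> D_const r * exp (\<kappa> * T w)" if "w \<in> G" for w
      unfolding F_def \<kappa>_def using that d u T_ge by (intro test_fun_le) (auto simp: G_def)
  qed (use G in auto)
  also have "\<dots> = D_const r * (\<Sum>w\<in>G. q w * exp (\<kappa> * T w))"
    by (simp add: sum_distrib_left mult_ac)
  also have "\<dots> \<le> D_const r * (2 * B)"
    using exp_G by (intro mult_left_mono) (simp_all add: D_const_def)
  finally have "0 \<le> - real r * (1 - sum q G) + D_const r * (2 * B)" by simp
  \<comment> \<open>Since \<open>r \<ge> 2\<close> and the complement of \<open>G\<close> has mass
    at least 1/2, the negative part is at most -1, while \<open>G\<close> contributes at most
    1/2.\<close>
  moreover have "2 * (1 / 2) \<le> real r * (1 - sum q G)"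
    using r sum_G beta by (intro mult_mono) auto
  ultimately show False using beta by simp
qed

section \<open>From independent copies to sums over weighted pairs\<close>

lemma (in prob_space) prob_independent_copies:
  assumes X: "finite X" and ind: "independent_copies M X U U'"
  defines "p \<equiv> \<lambda>x. prob (U -` {x} \<inter> space M)"
  shows "\<P>(\<omega> in M. P (U \<omega>) (U' \<omega>)) = (\<Sum>(x, y) | x \<in> X \<and> y \<in> X \<and> P x y. p x * p y)"
    and "sum p X = 1"
proof -
  have ind': "indep_var (count_space X) U (count_space X) U'"
    and eq: "distr M (count_space X) U = distr M (count_space X) U'"
    using ind unfolding independent_copies_def by blast+
  have U: "U \<in> measurable M (count_space X)" "U' \<in> measurable M (count_space X)"
    by (rule indep_var_rv1[OF ind'], rule indep_var_rv2[OF ind'])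
  have UX: "U \<omega> \<in> X" "U' \<omega> \<in> X" if "\<omega> \<in> space M" for \<omega>
    using measurable_space[OF U(1) that] measurable_space[OF U(2) that] by simp_all
  \<comment> \<open>Equality of the laws lets the single weight function \<open>p\<close> serve both
    variables.\<close>
  have p': "prob (U' -` {x} \<inter> space M) = p x" if "x \<in> X" for x
    using arg_cong[OF eq, of "\<lambda>N. measure N {x}"] U that by (simp add: measure_distr p_def)
  define A where "A = (\<lambda>(x, y). (\<lambda>\<omega>. (U \<omega>, U' \<omega>)) -` ({x} \<times> {y}) \<inter> space M)"
  define I where "I = {(x, y). x \<in> X \<and> y \<in> X \<and> P x y}"
  have "I \<subseteq> X \<times> X" by (auto simp: I_def)
  then have I: "finite I" by (rule finite_subset) (use X in simp)
  have A: "A (x, y) = (U -` {x} \<inter> space M) \<inter> (U' -` {y} \<inter> space M)" for x y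
    by (auto simp: A_def)
  have "A ` I \<subseteq> events"
    using measurable_sets[OF U(1)] measurable_sets[OF U(2)] by (auto simp: A I_def)
  moreover have "disjoint_family_on A I" by (auto simp: disjoint_family_on_def A_def)
  ultimately have "prob (\<Union>w\<in>I. A w) = (\<Sum>w\<in>I. prob (A w))"
    using I by (intro finite_measure_finite_Union)
  moreover have "{\<omega> \<in> space M. P (U \<omega>) (U' \<omega>)} = (\<Union>w\<in>I. A w)"
    using UX by (auto simp: A_def I_def)
  moreover have "prob (A (x, y)) = p x * p y" if "(x, y) \<in> I" for x y
    using indep_varD[OF ind', of "{x}" "{y}"] that p'[of y] by (auto simp: A_def p_def I_def)
  ultimately show "\<P>(\<omega> in M. P (U \<omega>) (U' \<omega>)) = (\<Sum>(x, y) | x \<in> X \<and> y \<in> X \<and> P x y. p x * p y)"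
    unfolding I_def by (auto intro!: sum.cong)
  have "prob (\<Union>x\<in>X. U -` {x} \<inter> space M) = sum p X"
    unfolding p_def using X measurable_sets[OF U(1)]
    by (intro finite_measure_finite_Union) (auto simp: disjoint_family_on_def)
  moreover have "(\<Union>x\<in>X. U -` {x} \<inter> space M) = space M" using UX by auto
  ultimately show "sum p X = 1" by (simp add: prob_space)
qed

section \<open>Growth of the explicit constants\<close>

lemma C_const_le:
  assumes "2 \<le> r" "3 \<le> d"
  shows "C_const r d \<le> 4 * real r * real d ^ 2 * ln (2 * real r * real d)"
proof -
  \<comment> \<open>All three entries of the maximum are bounded by \<open>d ^ 2 * ln a\<close>. The
    first uses \<open>a \<ge> 12 > exp 1\<close>, the other two the quadratic bounds on
    \<open>eta\<close> and \<open>gam\<close>.\<close>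
  define a where "a = 2 * real r * real d"
  have rd: "2 \<le> real r" "3 \<le> real d" using assms by auto
  have "2 * 2 * 3 \<le> a" unfolding a_def using rd by (intro mult_mono) auto
  then have a: "12 \<le> a" by simp
  have "1 = ln (exp 1 :: real)" by simp
  also have "\<dots> \<le> ln a" using exp_le a by (subst ln_le_cancel_iff) auto
  finally have ln_a: "1 \<le> ln a" .
  have d2: "3 * 3 \<le> real d ^ 2" using rd mult_mono[of 3 "real d" 3 "real d"] by (simp add: power2_eq_square)
  have "1 * 1 \<le> real d ^ 2 * ln a" using d2 ln_a by (intro mult_mono) auto
  then have 1: "1 \<le> real d ^ 2 * ln a" by simp
  have "ln (2 * (real d - 1)) \<le> ln a"
  proof -
    have "1 * (2 * (real d - 1)) \<le> real r * (2 * real d)" using rd by (intro mult_mono) auto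
    then show ?thesis using rd by (subst ln_le_cancel_iff) (auto simp: a_def)
  qed
  moreover have "ln a \<le> real d ^ 2 * ln a * eta d"
  proof -
    have "real d ^ 2 * ln a * (8 / real d ^ 2) \<le> real d ^ 2 * ln a * eta d"
      using eta_ge[of d] assms ln_a by (intro mult_left_mono) auto
    then show ?thesis using assms ln_a by simp
  qed
  moreover have "0 < 8 / real d ^ 2" "0 < 2 / real d ^ 2" using rd by auto
  then have pos: "0 < eta d" "0 < gam d" using eta_ge[of d] gam_ge[of d] assms by linarith+
  ultimately have 2: "ln (2 * (real d - 1)) / eta d \<le> real d ^ 2 * ln a"
    by (simp add: divide_le_eq)
  \<comment> \<open>As \<open>a ^ 3 = 8 * r ^ 3 * d ^ 3\<close>, this amounts to
    \<open>3 \<le> r ^ 2 * d\<close>. The exponent 3 is affordable because doubling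
    \<open>gam_ge\<close> gives \<open>4 / d ^ 2\<close>.\<close>
  have "24 * real d ^ 2 * real r \<le> a ^ 3"
  proof -
    have "3 \<le> real r ^ 2 * real d"
      using mult_mono[of 1 "real r ^ 2" 3 "real d"] rd by (simp add: one_le_power)
    then have "3 * (8 * real d ^ 2 * real r) \<le> real r ^ 2 * real d * (8 * real d ^ 2 * real r)"
      by (intro mult_right_mono) auto
    then show ?thesis by (simp add: a_def power2_eq_square power3_eq_cube mult_ac)
  qed
  then have "ln (24 * real d ^ 2 * real r) \<le> ln (a ^ 3)"
    using rd a by (subst ln_le_cancel_iff) auto
  also have "\<dots> = 3 * ln a" using a by (simp add: ln_realpow)
  also have "\<dots> \<le> real d ^ 2 * ln a * (2 * (2 / real d ^ 2))" using ln_a rd by simp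
  also have "\<dots> \<le> real d ^ 2 * ln a * (2 * gam d)"
    using gam_ge[of d] assms ln_a by (intro mult_left_mono) auto
  finally have 3: "ln (24 * real d ^ 2 * real r) / (2 * gam d) \<le> real d ^ 2 * ln a"
    using pos by (simp add: divide_le_eq)
  have "u_const r d \<le> real d ^ 2 * ln a"
    unfolding u_const_def using 1 2 3 by simp
  then have "4 * real r * u_const r d \<le> 4 * real r * (real d ^ 2 * ln a)"
    by (intro mult_left_mono) auto
  then show ?thesis by (simp add: C_const_def a_def mult.assoc)
qed

lemma ln_inverse_beta_le:
  assumes "2 \<le> r"
  shows "ln (1 / beta r) \<le> 4 * real r"
proof -
  have "4 * (real r * 2 ^ (r - 1)) * (real r + 1) \<le> 2 ^ (4 * r)"
  proof -
    have nat: "Suc r \<le> 2 ^ r" by (rule Suc_leI, rule less_exp)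
    have r: "real r + 1 \<le> 2 ^ r"
      using of_nat_mono[OF nat, where 'a = real] by simp
    have "4 * (real r * 2 ^ (r - 1)) * (real r + 1) = real r * 2 ^ (r + 1) * (real r + 1)"
      using assms by (cases r) auto
    \<comment> \<open>Crude bounds suffice: both \<open>r\<close> and \<open>r + 1\<close> are at
      most \<open>2 ^ r\<close>, and \<open>r + 1 \<le> 2 * r\<close>.\<close>
    also have "\<dots> \<le> 2 ^ r * 2 ^ (2 * r) * 2 ^ r"
      using r assms by (intro mult_mono power_increasing) auto
    finally show ?thesis by (simp add: power_add[symmetric])
  qed
  then have "ln (1 / beta r) \<le> ln (2 ^ (4 * r))"
    unfolding beta_def D_const_def using assms by (subst ln_le_cancel_iff) auto
  also have "\<dots> = 4 * real r * ln 2" by (simp add: ln_realpow)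
  also have "\<dots> \<le> 4 * real r * 1"
    using ln_2_less_1 by (intro mult_left_mono) auto
  finally show ?thesis by simp
qed

theorem theorem3p4:
  "(\<forall>(r::nat) (d::nat) (M :: 'w measure) (X :: 'x set) U U'
      (H :: nat \<Rightarrow> 'h inner_space) (\<sigma> :: nat \<Rightarrow> 'x \<Rightarrow> 'h).
      2 \<le> r \<longrightarrow> 3 \<le> d \<longrightarrow>
      prob_space M \<longrightarrow> finite X \<longrightarrow> independent_copies M X U U' \<longrightarrow>
      (\<forall>i\<in>{1..r}. real_hilbert_space (H i) \<and> \<sigma> i \<in> X \<rightarrow> carrier (H i)) \<longrightarrow>
      (\<exists>i\<in>{1..r}. \<exists>l::real. l \<ge> -1 \<and>
        \<P>(\<omega> in M. inner_prod (H i) (\<sigma> i (U \<omega>)) (\<sigma> i (U' \<omega>)) \<ge> l \<and>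
          (\<forall>j\<in>{1..r}. j \<noteq> i \<longrightarrow> inner_prod (H j) (\<sigma> j (U \<omega>)) (\<sigma> j (U' \<omega>)) \<ge> -1))
        \<ge> beta r * exp (- C_const r d * (l + 1) powr (1 / real d))))
   \<and>
   (\<exists>C1>0. \<exists>C2>0. \<forall>(r::nat) (d::nat). 2 \<le> r \<longrightarrow> 3 \<le> d \<longrightarrow>
      C_const r d \<le> C1 * real r * real d ^ 2 * ln (2 * real r * real d) \<and>
      ln (1 / beta r) \<le> C2 * real r)"
proof (intro conjI allI impI)
  fix r d :: nat and M :: "'w measure" and X :: "'x set" and U U'
    and H :: "nat \<Rightarrow> 'h inner_space" and \<sigma> :: "nat \<Rightarrow> 'x \<Rightarrow> 'h"
  assume r: "2 \<le> r" and d: "3 \<le> d" and M: "prob_space M" and X: "finite X"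
    and ind: "independent_copies M X U U'"
    and H: "\<forall>i\<in>{1..r}. real_hilbert_space (H i) \<and> \<sigma> i \<in> X \<rightarrow> carrier (H i)"
  interpret prob_space M by (rule M)
  define p where "p x = prob (U -` {x} \<inter> space M)" for x
  define K where "K i x y = inner_prod (H i) (\<sigma> i x) (\<sigma> i y)" for i x y
  have "psd_kernel X (K i)" if "i \<in> {1..r}" for i
    unfolding K_def using H that X by (intro real_hilbert_space.psd_kernel_inner_prod) auto
  then obtain i l where "i \<in> {1..r}" "-1 \<le> l"
    "beta r * exp (- C_const r d * (l + 1) powr (1 / real d)) \<le>
      (\<Sum>(x, y) | x \<in> X \<and> y \<in> X \<and> l \<le> K i x y \<and> (\<forall>j\<in>{1..r}. j \<noteq> i \<longrightarrow> -1 \<le> K j x y). p x * p y)"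
    using psd_kernels_large_values[OF r _ X, of d p K] d prob_independent_copies(2)[OF X ind]
    by (auto simp: p_def)
  then show "\<exists>i\<in>{1..r}. \<exists>l::real. l \<ge> -1 \<and>
        \<P>(\<omega> in M. inner_prod (H i) (\<sigma> i (U \<omega>)) (\<sigma> i (U' \<omega>)) \<ge> l \<and>
          (\<forall>j\<in>{1..r}. j \<noteq> i \<longrightarrow> inner_prod (H j) (\<sigma> j (U \<omega>)) (\<sigma> j (U' \<omega>)) \<ge> -1))
        \<ge> beta r * exp (- C_const r d * (l + 1) powr (1 / real d))"
    using prob_independent_copies(1)[OF X ind,
        of "\<lambda>x y. l \<le> K i x y \<and> (\<forall>j\<in>{1..r}. j \<noteq> i \<longrightarrow> -1 \<le> K j x y)"]
    by (intro bexI[of _ i] exI[of _ l]) (simp_all add: K_def p_def)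
next
  show "\<exists>C1>0. \<exists>C2>0. \<forall>(r::nat) (d::nat). 2 \<le> r \<longrightarrow> 3 \<le> d \<longrightarrow>
      C_const r d \<le> C1 * real r * real d ^ 2 * ln (2 * real r * real d) \<and>
      ln (1 / beta r) \<le> C2 * real r"
    using C_const_le ln_inverse_beta_le by (intro exI[of _ 4] conjI) auto
qed

end
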